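(* Let $\pi_t^{\mathrm{out}}\in\mathbb{R}^m$ be an optimal dual solution of the current restricted master problem, with $\mathcal Q_-(\pi_t^{\mathrm{out}})\neq\varnothing$, and assume $\bar a := \sup_{q\in Q}\|A_q\|_2<\infty$. Let $\pi_t^{\mathrm{ref}}\in\mathbb{R}^m$ be a reference dual point, let $\alpha_t\in[0,1)$, and let $\pi_t^{\mathrm{sep}}=\alpha_t\pi_t^{\mathrm{ref}}+(1-\alpha_t)\pi_t^{\mathrm{out}}$ (smoothing method). If either $\pi_t^{\mathrm{ref}}=\pi_t^{\mathrm{out}}$ or $$\alpha_t\ \le\ \frac{\min\{\gamma_t^-,\gamma_t^+\}}{2\,\bar a\,\|\pi_t^{\mathrm{ref}}-\pi_t^{\mathrm{out}}\|_2},$$ then $r_{q(\pi_t^{\mathrm{sep}})}(\pi_t^{\mathrm{out}})<0$ (for every column $q(\pi_t^{\mathrm{sep}})$ that the exact pricing oracle may return at $\pi_t^{\mathrm{sep}}$), and mispricing is prevented.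
   Context: Column generation setting. The master problem is the linear program $\min\{c^\top x : Ax=b,\ x\ge 0\}$ with $b\in\mathbb{R}^m$; $Q$ is the index set of all its columns, and column $q\in Q$ has coefficient vector $A_q\in\mathbb{R}^m$ and cost $c_q\in\mathbb{R}$. At iteration $t$ the restricted master problem (RMP) uses only the columns in a subset $R\subseteq Q$; its dual is $\max\{b^\top\pi : A_R^\top\pi\le c_R\}$, and $\pi_t^{\mathrm{out}}$ denotes an optimal solution of that dual. The reduced cost of column $q$ at $\pi\in\mathbb{R}^m$ is $r_q(\pi)=c_q-A_q^\top\pi$. The pricing problem at $\pi$ is $\sigma(\pi)=\min_{q\in Q}r_q(\pi)$; the pricing oracle is exact and returns a minimizer $q(\pi)\in\arg\min_{q\in Q}r_q(\pi)$. It is assumed that for every dual vector $\pi$ the pricing problem admits an optimal solution. In stabilized column generation, pricing is done at a stabilized dual $\pi_t^{\mathrm{sep}}$ instead of $\pi_t^{\mathrm{out}}$. Define $\mathcal Q_-(\pi_t^{\mathrm{out}})=\{q\in Q: r_q(\pi_t^{\mathrm{out}})<0\}$, $\mathcal Q_+(\pi_t^{\mathrm{out}})=\{q\in Q: r_q(\pi_t^{\mathrm{out}})\ge 0\}$, $\gamma_t^-=-\min_{q\in\mathcal Q_-(\pi_t^{\mathrm{out}})}r_q(\pi_t^{\mathrm{out}})$, and $\gamma_t^+=\min_{q\in\mathcal Q_+(\pi_t^{\mathrm{out}})}r_q(\pi_t^{\mathrm{out}})$, with $\gamma_t^+=+\infty$ if $\mathcal Q_+(\pi_t^{\mathrm{out}})=\varnothing$.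 Only iterations with $\mathcal Q_-(\pi_t^{\mathrm{out}})\ne\varnothing$ are considered. Mispricing: at iteration $t$, assuming $\sigma(\pi_t^{\mathrm{out}})<0$, a mispricing event occurs if the pricing oracle returns a column $q\in Q$ with $r_q(\pi_t^{\mathrm{out}})\ge 0$. *)

theory Defs
  imports "HOL-Analysis.Analysis"
begin

text \<open>
  The columns are indexed by a set \<open>Q\<close> (not necessarily finite); column \<open>q\<close> has coefficient
  vector \<open>A q\<close> and cost \<open>c q\<close>.
\<close>

definition reduced_cost :: "('q \<Rightarrow> real ^ 'm) \<Rightarrow> ('q \<Rightarrow> real) \<Rightarrow> 'q \<Rightarrow> real ^ 'm \<Rightarrow> real" where
  "reduced_cost A c q \<pi> = c q - A q \<bullet> \<pi>"

text \<open>
  The dual of the restricted master problem over the columns \<open>R\<close> is to maximize \<open>b \<bullet> \<pi>\<close> subject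
  to \<open>A q \<bullet> \<pi> \<le> c q\<close> for all \<open>q \<in> R\<close>.
\<close>

definition rmp_dual_feasible :: "('q \<Rightarrow> real ^ 'm) \<Rightarrow> ('q \<Rightarrow> real) \<Rightarrow> 'q set \<Rightarrow> (real ^ 'm) set" where
  "rmp_dual_feasible A c R = {\<pi>. \<forall>q\<in>R. A q \<bullet> \<pi> \<le> c q}"

definition rmp_dual_optimal ::
    "('q \<Rightarrow> real ^ 'm) \<Rightarrow> real ^ 'm \<Rightarrow> ('q \<Rightarrow> real) \<Rightarrow> 'q set \<Rightarrow> real ^ 'm \<Rightarrow> bool" where
  "rmp_dual_optimal A b c R \<pi> \<longleftrightarrow> is_arg_max (\<lambda>p. b \<bullet> p) (\<lambda>p. p \<in> rmp_dual_feasible A c R) \<pi>"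

text \<open>
  Optimal values are infima in the extended reals, so that they agree with the minimum whenever it
  is attained and equal \<open>\<infinity>\<close> over the empty set.
\<close>

definition pricing_value :: "'q set \<Rightarrow> ('q \<Rightarrow> real ^ 'm) \<Rightarrow> ('q \<Rightarrow> real) \<Rightarrow> real ^ 'm \<Rightarrow> ereal" where
  "pricing_value Q A c \<pi> = (INF q\<in>Q. ereal (reduced_cost A c q \<pi>))"

text \<open>The columns an exact pricing oracle may return at \<open>\<pi>\<close> are the minimizers of the reduced cost.\<close>

definition pricing_argmin ::
    "'q set \<Rightarrow> ('q \<Rightarrow> real ^ 'm) \<Rightarrow> ('q \<Rightarrow> real) \<Rightarrow> real ^ 'm \<Rightarrow> 'q set" where
  "pricing_argmin Q A c \<pi> = {q. is_arg_min (\<lambda>p. reduced_cost A c p \<pi>) (\<lambda>p. p \<in> Q) q}"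

definition Q_minus :: "'q set \<Rightarrow> ('q \<Rightarrow> real ^ 'm) \<Rightarrow> ('q \<Rightarrow> real) \<Rightarrow> real ^ 'm \<Rightarrow> 'q set" where
  "Q_minus Q A c \<pi> = {q \<in> Q. reduced_cost A c q \<pi> < 0}"

definition Q_plus :: "'q set \<Rightarrow> ('q \<Rightarrow> real ^ 'm) \<Rightarrow> ('q \<Rightarrow> real) \<Rightarrow> real ^ 'm \<Rightarrow> 'q set" where
  "Q_plus Q A c \<pi> = {q \<in> Q. reduced_cost A c q \<pi> \<ge> 0}"

definition gamma_minus :: "'q set \<Rightarrow> ('q \<Rightarrow> real ^ 'm) \<Rightarrow> ('q \<Rightarrow> real) \<Rightarrow> real ^ 'm \<Rightarrow> ereal" where
  "gamma_minus Q A c \<pi> = - (INF q\<in>Q_minus Q A c \<pi>. ereal (reduced_cost A c q \<pi>))"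

definition gamma_plus :: "'q set \<Rightarrow> ('q \<Rightarrow> real ^ 'm) \<Rightarrow> ('q \<Rightarrow> real) \<Rightarrow> real ^ 'm \<Rightarrow> ereal" where
  "gamma_plus Q A c \<pi> = (INF q\<in>Q_plus Q A c \<pi>. ereal (reduced_cost A c q \<pi>))"

text \<open>
  If this supremum is \<open>0\<close>, an \<open>ereal\<close> quotient by it is \<open>\<infinity>\<close> for a positive numerator
  and \<open>0\<close> for the numerator \<open>0\<close>.
\<close>

definition sup_column_norm :: "'q set \<Rightarrow> ('q \<Rightarrow> real ^ 'm) \<Rightarrow> ereal" where
  "sup_column_norm Q A = (SUP q\<in>Q. ereal (norm (A q)))"

text \<open>
  Mispricing is a joint event of the unstabilized dual \<open>\<pi>_out\<close> and the column \<open>q\<close> returned by the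
  oracle, which may have been called at a different dual point.
\<close>

definition mispricing ::
    "'q set \<Rightarrow> ('q \<Rightarrow> real ^ 'm) \<Rightarrow> ('q \<Rightarrow> real) \<Rightarrow> real ^ 'm \<Rightarrow> 'q \<Rightarrow> bool" where
  "mispricing Q A c \<pi>_out q \<longleftrightarrow>
     pricing_value Q A c \<pi>_out < 0 \<and> q \<in> Q \<and> reduced_cost A c q \<pi>_out \<ge> 0"

end

theory Submission
  imports Defs
begin

text \<open>
  Put \<open>d = \<pi>_ref - \<pi>_out\<close>, and let \<open>p\<close> be a column with \<open>r_p(\<pi>_out) < 0\<close>. If the oracle returned a
  column \<open>q\<close> with \<open>r_q(\<pi>_out) \<ge> 0\<close>, then comparing \<open>q\<close> with \<open>p\<close> at \<open>\<pi>_sep\<close> and applying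
  Cauchy--Schwarz would give \<open>r_q(\<pi>_out) - r_p(\<pi>_out) \<le> \<alpha> (A_q - A_p) \<bullet> d \<le> 2 \<alpha> a \<parallel>d\<parallel>\<close>, where
  \<open>a\<close> bounds the column norms. The step size condition bounds the right-hand side by
  \<open>\<gamma>\<^sup>+ \<le> r_q(\<pi>_out)\<close>, so that \<open>r_p(\<pi>_out) \<ge> 0\<close>, a contradiction.
\<close>

text \<open>The reduced cost is affine in the dual point, so smoothing only adds a term linear in
  \<open>A q\<close>.\<close>

lemma reduced_cost_smoothed:
  "reduced_cost A c q (\<alpha> *\<^sub>R y + (1 - \<alpha>) *\<^sub>R x) = reduced_cost A c q x - \<alpha> * (A q \<bullet> (y - x))"
  by (simp add: reduced_cost_def algebra_simps)

lemma pricing_argmin_iff: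
  "q \<in> pricing_argmin Q A c x \<longleftrightarrow>
     q \<in> Q \<and> (\<forall>p\<in>Q. reduced_cost A c q x \<le> reduced_cost A c p x)"
  by (auto simp: pricing_argmin_def is_arg_min_linorder)

lemma pricing_argmin_smoothed_gap:
  assumes q: "q \<in> pricing_argmin Q A c (\<alpha> *\<^sub>R y + (1 - \<alpha>) *\<^sub>R x)" and p: "p \<in> Q"
    and bound: "\<And>q. q \<in> Q \<Longrightarrow> norm (A q) \<le> a" and "0 \<le> \<alpha>"
  shows "reduced_cost A c q x - reduced_cost A c p x \<le> \<alpha> * (2 * a * norm (y - x))"
proof -
  have "q \<in> Q" using q by (simp add: pricing_argmin_iff)
  have "reduced_cost A c q x - \<alpha> * (A q \<bullet> (y - x)) \<le> reduced_cost A c p x - \<alpha> * (A p \<bullet> (y - x))"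
    using q p by (simp add: pricing_argmin_iff reduced_cost_smoothed)
  then have "reduced_cost A c q x - reduced_cost A c p x \<le> \<alpha> * ((A q - A p) \<bullet> (y - x))"
    unfolding inner_diff_left[of "A q"] right_diff_distrib by linarith
  moreover have "(A q - A p) \<bullet> (y - x) \<le> 2 * a * norm (y - x)"
  proof -
    \<comment> \<open>Each of the two columns contributes \<open>a\<close>: this is the factor 2 in
      the step size condition.\<close>
    have "norm (A q - A p) \<le> 2 * a"
      using norm_triangle_ineq4[of "A q" "A p"] bound[OF \<open>q \<in> Q\<close>] bound[OF p] by linarith
    then show ?thesis
      by (meson norm_cauchy_schwarz mult_right_mono norm_ge_zero order_trans)
  qed
  ultimately show ?thesis
    using \<open>0 \<le> \<alpha>\<close> by (meson mult_left_mono order_trans)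
qed

text \<open>Passes from \<open>ereal\<close> to a real bound; a column must exist, since the
  supremum over the empty set is -\<infinity>.\<close>

lemma sup_column_norm_finiteE:
  assumes "sup_column_norm Q A < \<infinity>" and "Q \<noteq> {}"
  obtains a where "sup_column_norm Q A = ereal a" and "0 \<le> a"
    and "\<And>q. q \<in> Q \<Longrightarrow> norm (A q) \<le> a"
proof -
  have le: "ereal (norm (A q)) \<le> sup_column_norm Q A" if "q \<in> Q" for q
    unfolding sup_column_norm_def using that by (rule SUP_upper)
  obtain p where p: "p \<in> Q" using assms(2) by blast
  obtain a where a: "sup_column_norm Q A = ereal a"
    using le[OF p] assms(1) by (cases "sup_column_norm Q A") auto
  have "norm (A q) \<le> a" if "q \<in> Q" for q
    using le[OF that] a by simp
  moreover from this[OF p] have "0 \<le> a"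
    using norm_ge_zero order_trans by blast
  ultimately show thesis using that a by blast
qed

theorem corollary1:
  fixes Q R :: "'q set"
    and A :: "'q \<Rightarrow> real ^ 'm"
    and b :: "real ^ 'm"
    and c :: "'q \<Rightarrow> real"
    and \<pi>_out \<pi>_ref \<pi>_sep :: "real ^ 'm"
    and \<alpha> :: real
  assumes "R \<subseteq> Q"
    and pricing_solvable: "\<And>\<pi>. pricing_argmin Q A c \<pi> \<noteq> {}"
    and "rmp_dual_optimal A b c R \<pi>_out"
    and "Q_minus Q A c \<pi>_out \<noteq> {}"
    and "sup_column_norm Q A < \<infinity>"
    and "0 \<le> \<alpha>" "\<alpha> < 1"
    and "\<pi>_sep = \<alpha> *\<^sub>R \<pi>_ref + (1 - \<alpha>) *\<^sub>R \<pi>_out"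
    and "\<pi>_ref = \<pi>_out \<or>
      ereal \<alpha> \<le> min (gamma_minus Q A c \<pi>_out) (gamma_plus Q A c \<pi>_out) /
                 (2 * sup_column_norm Q A * ereal (norm (\<pi>_ref - \<pi>_out)))"
  shows "\<forall>q \<in> pricing_argmin Q A c \<pi>_sep.
           reduced_cost A c q \<pi>_out < 0 \<and> \<not> mispricing Q A c \<pi>_out q"
proof -
  obtain p where p: "p \<in> Q" "reduced_cost A c p \<pi>_out < 0"
    using assms(4) by (auto simp: Q_minus_def)
  then obtain a where a: "sup_column_norm Q A = ereal a" "0 \<le> a"
    and bound: "\<And>q. q \<in> Q \<Longrightarrow> norm (A q) \<le> a"
    using sup_column_norm_finiteE[OF assms(5)] by blast
  define D where "D = 2 * a * norm (\<pi>_ref - \<pi>_out)"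
  have "reduced_cost A c q \<pi>_out < 0" if q: "q \<in> pricing_argmin Q A c \<pi>_sep" for q
  proof (rule ccontr)
    assume "\<not> ?thesis"
    then have nonneg: "0 \<le> reduced_cost A c q \<pi>_out" by simp
    have gap: "reduced_cost A c q \<pi>_out - reduced_cost A c p \<pi>_out \<le> \<alpha> * D"
      unfolding D_def
      by (rule pricing_argmin_smoothed_gap[OF q[unfolded assms(8)] p(1) bound assms(6)])
    have "0 \<le> D" using a(2) by (simp add: D_def)
    \<comment> \<open>When \<open>D = 0\<close> the step size condition may read \<open>\<alpha> \<le> \<infinity>\<close>, but then the gap is already \<open>\<le> 0\<close>.\<close>
    moreover have "D \<noteq> 0" using gap nonneg p(2) by auto
    ultimately have "0 < D" by simp
    \<comment> \<open>\<open>D \<noteq> 0\<close> excludes \<open>\<pi>_ref = \<pi>_out\<close>, so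
      the step size condition holds, with denominator \<open>D\<close>.\<close>
    have "ereal \<alpha> \<le> min (gamma_minus Q A c \<pi>_out) (gamma_plus Q A c \<pi>_out) / ereal D"
      using assms(9) \<open>D \<noteq> 0\<close> a(1) by (auto simp: D_def)
    also have "\<dots> \<le> ereal (reduced_cost A c q \<pi>_out) / ereal D"
    proof (rule ereal_divide_right_mono)
      \<comment> \<open>By the contrary assumption \<open>q\<close> lies in \<open>Q_plus\<close>,
        so it competes in the infimum.\<close>
      have "gamma_plus Q A c \<pi>_out \<le> ereal (reduced_cost A c q \<pi>_out)"
        unfolding gamma_plus_def
        using q nonneg by (intro INF_lower) (simp add: Q_plus_def pricing_argmin_iff)
      then show "min (gamma_minus Q A c \<pi>_out) (gamma_plus Q A c \<pi>_out)
          \<le> ereal (reduced_cost A c q \<pi>_out)"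
        by (rule min.coboundedI2)
    qed (use \<open>0 < D\<close> in simp)
    finally have "\<alpha> * D \<le> reduced_cost A c q \<pi>_out"
      using \<open>0 < D\<close> by (simp add: pos_le_divide_eq)
    with gap p(2) show False by linarith
  qed
  then show ?thesis by (force simp: mispricing_def)
qed

end
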